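(* Let $D=(V,A)$ be a finite connected complete monotone $r$-partite digraph with parts $V_1,\ldots,V_r$; that is, $V$ is the disjoint union of nonempty sets $V_1,\ldots,V_r$ and $A=\{(u,w): u\in V_i,\ w\in V_j,\ 1\le i<j\le r\}$. Define $s_r=|V_r|$ and $s_i=\max\{1+s_{i+1},|V_i|\}$ for $i=1,\ldots,r-1$. Then $$\eta_t(D)=\max\left\{\left\lceil\frac{s_i}{|V_i|}\right\rceil : i=1,\ldots,r\right\}.$$
   Context: For a directed acyclic graph $D=(V,A)$, $N(v)$ denotes the set of neighbors of $v$ in the undirected underlying graph $G(D)$ of $D$ (both in- and out-neighbors). $\mathbb{N}$ denotes the positive integers. For a labeling $f:V\to\mathbb{N}$, put $S(v)=\sum_{w\in N(v)}f(w)$. The labeling $f$ is a topological additive numbering of $D$ if $S(u)<S(v)$ for every $(u,v)\in A$; it is a topological additive $k$-numbering if moreover $k$ is the largest label used in $f$. If $D$ has at least one topological additive numbering, $\eta_t(D)$ is the least $k$ for which $D$ has a topological additive $k$-numbering; the assertion includes that $\eta_t(D)$ is defined, i.e. that $D$ has a topological additive numbering. A digraph $D$ is (complete) $r$-partite if $G(D)$ is (complete) $r$-partite, and an $r$-partite digraph is monotone if it can be partitioned into $V_1,\ldots,V_r$ (the parts, each an independent set) so that every arc in $V_i\times V_j$ satisfies $i<j$. *)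

theory Defs
  imports Complex_Main "HOL-Library.Disjoint_Sets" "Graph_Theory.Digraph_Component"
begin

text \<open>
  Digraphs are pairs of a vertex set and a set of ordered pairs of vertices. The underlying graph
  is \<^const>\<open>mk_symmetric\<close>, on which the library's \<^const>\<open>connected\<close> is also based.
\<close>

definition neighbors :: "'a pair_pre_digraph \<Rightarrow> 'a \<Rightarrow> 'a set" where
  "neighbors D v = {w. (v, w) \<in> parcs (mk_symmetric D)}"

definition neighbor_sum :: "'a pair_pre_digraph \<Rightarrow> ('a \<Rightarrow> nat) \<Rightarrow> 'a \<Rightarrow> nat" where
  "neighbor_sum D f v = (\<Sum>w\<in>neighbors D v. f w)"

text \<open>
  Labels are positive; values of the labeling outside the vertex set are irrelevant. Acyclicity is
  not required separately: every digraph with such a labeling is acyclic.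
\<close>

definition topological_additive_numbering :: "'a pair_pre_digraph \<Rightarrow> ('a \<Rightarrow> nat) \<Rightarrow> bool" where
  "topological_additive_numbering D f \<longleftrightarrow>
     (\<forall>v\<in>pverts D. 1 \<le> f v) \<and>
     (\<forall>(u, v)\<in>parcs D. neighbor_sum D f u < neighbor_sum D f v)"

definition topological_additive_k_numbering ::
    "'a pair_pre_digraph \<Rightarrow> nat \<Rightarrow> ('a \<Rightarrow> nat) \<Rightarrow> bool" where
  "topological_additive_k_numbering D k f \<longleftrightarrow>
     topological_additive_numbering D f \<and>
     k \<in> f ` pverts D \<and> (\<forall>v\<in>pverts D. f v \<le> k)"

text \<open>
  Only meaningful for nonempty finite \<open>D\<close> that have a topological additive numbering; otherwise the
  value of \<open>LEAST\<close> is arbitrary.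
\<close>

definition eta_t :: "'a pair_pre_digraph \<Rightarrow> nat" where
  "eta_t D = (LEAST k. \<exists>f. topological_additive_k_numbering D k f)"

definition complete_monotone_partite ::
    "nat \<Rightarrow> (nat \<Rightarrow> 'a set) \<Rightarrow> 'a pair_pre_digraph \<Rightarrow> bool" where
  "complete_monotone_partite r V D \<longleftrightarrow>
     1 \<le> r \<and>
     (\<forall>i\<in>{1..r}. V i \<noteq> {}) \<and>
     disjoint_family_on V {1..r} \<and>
     pverts D = (\<Union>i\<in>{1..r}. V i) \<and>
     parcs D = {(u, w). \<exists>i j. 1 \<le> i \<and> i < j \<and> j \<le> r \<and> u \<in> V i \<and> w \<in> V j}"

end

theory Submission
  imports Defs
begin

text \<open>
  In a complete multipartite digraph the neighbours of a vertex of \<open>V i\<close> are all vertices outside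
  \<open>V i\<close>, so a positive labeling is a topological additive numbering iff the label totals of the
  parts strictly decrease. As the total of \<open>V i\<close> is at least \<open>card (V i)\<close>, the smallest possible
  totals are the numbers \<open>s i\<close>; and labels in \<open>{1..k}\<close> realise every total from
  \<open>card (V i)\<close> to \<open>k * card (V i)\<close>.
\<close>

section \<open>Label totals of a single set, and the least bound on labels\<close>

lemma neighbors_iff: "w \<in> neighbors D v \<longleftrightarrow> (v, w) \<in> parcs D \<or> (w, v) \<in> parcs D"
  by (auto simp: neighbors_def parcs_mk_symmetric intro: bexI[of _ "(w, v)"])

text \<open>Induction on \<open>m\<close>: the all-ones labeling has the smallest total, and while
  the total is below \<open>k * card A\<close> some label is below \<open>k\<close> and can be
  raised by one.\<close>

lemma sum_bounded_labels:
  fixes A :: "'a set" and m k :: nat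
  assumes "finite A" "card A \<le> m" "m \<le> k * card A"
  shows "\<exists>f. (\<forall>x\<in>A. 1 \<le> f x \<and> f x \<le> k) \<and> sum f A = m"
  using assms(2,3)
proof (induction m rule: dec_induct)
  case base
  then show ?case
    \<comment> \<open>For nonempty \<open>A\<close>, the bound
      \<open>card A \<le> k * card A\<close> forces \<open>1 \<le> k\<close>, so the constant label
      1 is admissible.\<close>
    by (cases "A = {}") (use assms(1) in \<open>auto intro!: exI[of _ "\<lambda>_. 1"]\<close>)
next
  case (step m)
  then obtain f where f: "\<forall>x\<in>A. 1 \<le> f x \<and> f x \<le> k" "sum f A = m"
    by auto
  have "\<exists>x\<in>A. f x < k"
  proof (rule ccontr)
    assume "\<not> ?thesis"
    then have "sum (\<lambda>_. k) A \<le> sum f A"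
      by (intro sum_mono) auto
    with f(2) step.prems show False
      by (simp add: mult.commute)
  qed
  then obtain x where x: "x \<in> A" "f x < k"
    by blast
  define g where "g = f(x := Suc (f x))"
  have "sum g (A - {x}) = sum f (A - {x})"
    unfolding g_def by (rule sum.cong) auto
  then have "sum g A = Suc m"
    using f(2) sum.remove[OF assms(1) x(1), of g] sum.remove[OF assms(1) x(1), of f]
    by (simp add: g_def)
  moreover have "\<forall>y\<in>A. 1 \<le> g y \<and> g y \<le> k"
    using f(1) x unfolding g_def by auto
  ultimately show ?case
    by blast
qed

text \<open>Replaces "\<open>k\<close> is the largest label used" by "\<open>k\<close> bounds all
  labels", which is easier to characterise. The two have the same least value because a least bound
  must be attained.\<close>

lemma eta_t_eqI:
  assumes "finite (pverts D)" "pverts D \<noteq> {}"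
    and "\<And>k. (\<exists>f. topological_additive_numbering D f \<and> (\<forall>v\<in>pverts D. f v \<le> k)) \<longleftrightarrow> K \<le> k"
  shows "eta_t D = K"
  unfolding eta_t_def
proof (rule Least_equality)
  obtain f where f: "topological_additive_numbering D f" "\<forall>v\<in>pverts D. f v \<le> K"
    using assms(3)[of K] by auto
  \<comment> \<open>The largest label of \<open>f\<close> is itself a bound for \<open>f\<close>, so
    the equivalence applies with \<open>k\<close> equal to it.\<close>
  have "K \<le> Max (f ` pverts D)"
    using assms(1) f(1) by (subst assms(3)[symmetric]) auto
  moreover have "Max (f ` pverts D) \<in> f ` pverts D"
    using assms(1,2) by (intro Max_in) auto
  ultimately have "K \<in> f ` pverts D"
    using f(2) by fastforce
  with f show "\<exists>f. topological_additive_k_numbering D K f"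
    unfolding topological_additive_k_numbering_def by blast
next
  fix k
  assume "\<exists>f. topological_additive_k_numbering D k f"
  then show "K \<le> k"
    unfolding topological_additive_k_numbering_def assms(3)[symmetric] by blast
qed

section \<open>Neighbour sums and numberings in a complete monotone partite digraph\<close>

context
  fixes D :: "'a pair_pre_digraph" and V :: "nat \<Rightarrow> 'a set" and r :: nat
  assumes finite_pverts: "finite (pverts D)"
    and partite: "complete_monotone_partite r V D"
begin

lemma pverts_eq: "pverts D = (\<Union>i\<in>{1..r}. V i)"
  using partite by (simp add: complete_monotone_partite_def)

lemma parcs_eq:
  "parcs D = {(u, w). \<exists>i j. 1 \<le> i \<and> i < j \<and> j \<le> r \<and> u \<in> V i \<and> w \<in> V j}"
  using partite by (simp add: complete_monotone_partite_def)

lemma parcs_partsE: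
  assumes "(u, w) \<in> parcs D"
  obtains i j where "i \<in> {1..r}" "j \<in> {1..r}" "i < j" "u \<in> V i" "w \<in> V j"
proof -
  obtain i j where "1 \<le> i" "i < j" "j \<le> r" "u \<in> V i" "w \<in> V j"
    using assms unfolding parcs_eq by blast
  then show thesis
    by (intro that[of i j]) auto
qed

lemma parcs_partsI:
  assumes "i \<in> {1..r}" "j \<in> {1..r}" "i < j" "u \<in> V i" "w \<in> V j"
  shows "(u, w) \<in> parcs D"
  using assms unfolding parcs_eq by auto

lemma part_index_unique:
  assumes "i \<in> {1..r}" "j \<in> {1..r}" "v \<in> V i" "v \<in> V j"
  shows "i = j"
proof (rule ccontr)
  assume "i \<noteq> j"
  moreover have "disjoint_family_on V {1..r}"
    using partite by (simp add: complete_monotone_partite_def)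
  ultimately have "V i \<inter> V j = {}"
    using assms(1,2) by (simp add: disjoint_family_on_def)
  with assms(3,4) show False
    by blast
qed

lemma part_nonempty: "i \<in> {1..r} \<Longrightarrow> V i \<noteq> {}"
  using partite by (simp add: complete_monotone_partite_def)

lemma part_subset_pverts: "i \<in> {1..r} \<Longrightarrow> V i \<subseteq> pverts D"
  unfolding pverts_eq by blast

lemma finite_part: "i \<in> {1..r} \<Longrightarrow> finite (V i)"
  using part_subset_pverts finite_pverts by (rule finite_subset)

lemma card_part_pos: "i \<in> {1..r} \<Longrightarrow> 0 < card (V i)"
  using part_nonempty finite_part by (simp add: card_gt_0_iff)

text \<open>Vertices of distinct parts are joined by an arc in the direction of increasing index;
  disjointness of the parts excludes arcs inside a part.\<close>

lemma neighbors_part: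
  assumes i: "i \<in> {1..r}" and v: "v \<in> V i"
  shows "neighbors D v = pverts D - V i"
proof -
  have "w \<in> neighbors D v \<longleftrightarrow> w \<in> pverts D - V i" for w
  proof
    assume "w \<in> neighbors D v"
    then have "(v, w) \<in> parcs D \<or> (w, v) \<in> parcs D"
      by (simp add: neighbors_iff)
    then obtain a b where ab: "a \<in> {1..r}" "b \<in> {1..r}" "a \<noteq> b" "v \<in> V a" "w \<in> V b"
      by (metis parcs_partsE less_irrefl)
    then have "a = i"
      using part_index_unique[of a i v] i v by simp
    then have "w \<notin> V i"
      using ab i part_index_unique[of b i w] by auto
    then show "w \<in> pverts D - V i"
      using ab part_subset_pverts by blast
  next
    assume w: "w \<in> pverts D - V i"
    then obtain j where j: "j \<in> {1..r}" "w \<in> V j" "j \<noteq> i"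
      unfolding pverts_eq by blast
    then have "(v, w) \<in> parcs D \<or> (w, v) \<in> parcs D"
      using i v parcs_partsI[of i j v w] parcs_partsI[of j i w v] by (meson linorder_neqE_nat)
    then show "w \<in> neighbors D v"
      by (simp add: neighbors_iff)
  qed
  then show ?thesis
    by blast
qed

text \<open>Written additively to avoid truncated subtraction. The right-hand side does not depend
  on \<open>v\<close>, so a larger neighbour sum means a smaller part total.\<close>

lemma neighbor_sum_part:
  assumes "i \<in> {1..r}" "v \<in> V i"
  shows "neighbor_sum D f v + sum f (V i) = sum f (pverts D)"
  unfolding neighbor_sum_def neighbors_part[OF assms]
  using sum.subset_diff[OF part_subset_pverts[OF assms(1)] finite_pverts, of f] by simp

text \<open>The inequality along an arc depends only on the two parts it joins, and since parts are
  nonempty every pair \<open>i < j\<close> is witnessed by an arc.\<close>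

lemma topological_additive_numbering_iff:
  "topological_additive_numbering D f \<longleftrightarrow>
     (\<forall>v\<in>pverts D. 1 \<le> f v) \<and>
     (\<forall>i j. 1 \<le> i \<longrightarrow> i < j \<longrightarrow> j \<le> r \<longrightarrow> sum f (V j) < sum f (V i))"
proof -
  have arc: "neighbor_sum D f u < neighbor_sum D f w \<longleftrightarrow> sum f (V j) < sum f (V i)"
    if "1 \<le> i" "i < j" "j \<le> r" "u \<in> V i" "w \<in> V j" for i j u w
    using neighbor_sum_part[of i u f] neighbor_sum_part[of j w f] that by auto
  have "(\<forall>(u, w)\<in>parcs D. neighbor_sum D f u < neighbor_sum D f w) \<longleftrightarrow>
      (\<forall>i j. 1 \<le> i \<longrightarrow> i < j \<longrightarrow> j \<le> r \<longrightarrow> sum f (V j) < sum f (V i))" (is "?L \<longleftrightarrow> ?R")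
  proof
    assume L: ?L
    show ?R
    proof (intro allI impI)
      fix i j :: nat
      assume ij: "1 \<le> i" "i < j" "j \<le> r"
      then obtain u w where uw: "u \<in> V i" "w \<in> V j"
        using part_nonempty[of i] part_nonempty[of j] by auto
      have "(u, w) \<in> parcs D"
        using ij uw by (intro parcs_partsI) auto
      with L have "neighbor_sum D f u < neighbor_sum D f w"
        by blast
      then show "sum f (V j) < sum f (V i)"
        using arc[OF ij uw] by blast
    qed
  next
    assume R: ?R
    show ?L
    proof clarify
      fix u w
      assume "(u, w) \<in> parcs D"
      then obtain i j where ij: "1 \<le> i" "i < j" "j \<le> r" and uw: "u \<in> V i" "w \<in> V j"
        by (elim parcs_partsE) auto
      then show "neighbor_sum D f u < neighbor_sum D f w"
        using arc[OF ij uw] R by blast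
    qed
  qed
  then show ?thesis
    by (simp only: topological_additive_numbering_def)
qed

text \<open>The values \<open>s i\<close> are lower bounds for the part totals of every numbering,
  and they can all be attained at once by labels up to \<open>k\<close> exactly when each fits under
  \<open>k * card (V i)\<close>.\<close>

lemma bounded_numbering_iff:
  fixes s :: "nat \<Rightarrow> nat"
  assumes s_last: "s r = card (V r)"
    and s_step: "\<And>i. 1 \<le> i \<Longrightarrow> i < r \<Longrightarrow> s i = max (1 + s (i + 1)) (card (V i))"
  shows "(\<exists>f. topological_additive_numbering D f \<and> (\<forall>v\<in>pverts D. f v \<le> k)) \<longleftrightarrow>
    (\<forall>i\<in>{1..r}. s i \<le> k * card (V i))"
proof
  assume "\<exists>f. topological_additive_numbering D f \<and> (\<forall>v\<in>pverts D. f v \<le> k)"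
  then obtain f where num: "topological_additive_numbering D f" and le: "\<forall>v\<in>pverts D. f v \<le> k"
    by blast
  have pos: "\<forall>v\<in>pverts D. 1 \<le> f v"
    using num by (simp add: topological_additive_numbering_iff)
  have decr: "sum f (V j) < sum f (V i)" if "1 \<le> i" "i < j" "j \<le> r" for i j
    using num that by (simp add: topological_additive_numbering_iff)
  have card_le: "card (V i) \<le> sum f (V i)" if "i \<in> {1..r}" for i
    using sum_mono[of "V i" "\<lambda>_. 1" f] pos part_subset_pverts[OF that] by auto
  show "\<forall>i\<in>{1..r}. s i \<le> k * card (V i)"
  proof
    fix i
    assume i: "i \<in> {1..r}"
    then have "i \<le> r" "1 \<le> i"
      by auto
    then have "s i \<le> sum f (V i)"
    \<comment> \<open>Downward from \<open>r\<close>, following the recursion for \<open>s\<close>: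
      the total of \<open>V i\<close> is at least its size and exceeds the total of
      \<open>V (Suc i)\<close> by at least 1.\<close>
    proof (induction rule: inc_induct)
      case base
      then show ?case
        using card_le[of r] s_last by simp
    next
      case (step i)
      then show ?case
        using card_le[of i] s_step[of i] decr[of i "Suc i"] by auto
    qed
    also have "\<dots> \<le> sum (\<lambda>_. k) (V i)"
      using le part_subset_pverts[OF i] by (intro sum_mono) blast
    finally show "s i \<le> k * card (V i)"
      by (simp add: mult.commute)
  qed
next
  assume bound: "\<forall>i\<in>{1..r}. s i \<le> k * card (V i)"
  have s_decr: "s j < s i" if "1 \<le> i" "i < j" "j \<le> r" for i j
  proof -
    from that(2) have "Suc i \<le> j"
      by simp
    then show ?thesis
      using that(3)
    proof (induction j rule: dec_induct)
      case base
      then show ?case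
        using s_step[of i] that(1) by simp
    next
      case (step j)
      then show ?case
        using s_step[of j] that(1) by simp
    qed
  qed
  have card_le: "card (V i) \<le> s i" if "i \<in> {1..r}" for i
    using that s_last s_step[of i] by (cases "i = r") auto
  \<comment> \<open>Each part is labeled separately with total exactly \<open>s i\<close>; these
    totals already decrease strictly by \<open>s_decr\<close>.\<close>
  have "\<forall>i\<in>{1..r}. \<exists>g. (\<forall>x\<in>V i. 1 \<le> g x \<and> g x \<le> k) \<and> sum g (V i) = s i"
    using bound by (intro ballI sum_bounded_labels finite_part card_le) auto
  from bchoice[OF this] obtain g where g: "\<And>i x. i \<in> {1..r} \<Longrightarrow> x \<in> V i \<Longrightarrow> 1 \<le> g i x \<and> g i x \<le> k"
    "\<And>i. i \<in> {1..r} \<Longrightarrow> sum (g i) (V i) = s i"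
    by blast
  \<comment> \<open>Glues the labelings of the parts; the index chosen by \<open>THE\<close> is
    unique because the parts are disjoint.\<close>
  define f where "f v = g (THE i. i \<in> {1..r} \<and> v \<in> V i) v" for v
  have f_part: "f v = g i v" if "i \<in> {1..r}" "v \<in> V i" for i v
  proof -
    have "(THE i. i \<in> {1..r} \<and> v \<in> V i) = i"
      using that by (intro the_equality part_index_unique[of _ i v]) auto
    then show ?thesis
      unfolding f_def by simp
  qed
  have "sum f (V i) = s i" if "i \<in> {1..r}" for i
    using f_part g(2) that by simp
  moreover have "\<forall>v\<in>pverts D. 1 \<le> f v \<and> f v \<le> k"
    using f_part g(1) by (auto simp: pverts_eq)
  ultimately show "\<exists>f. topological_additive_numbering D f \<and> (\<forall>v\<in>pverts D. f v \<le> k)"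
    unfolding topological_additive_numbering_iff
    using s_decr by (intro exI[of _ f]) auto
qed

end

section \<open>The formula for \<open>eta_t\<close>\<close>

theorem proposition3:
  fixes D :: "'a pair_pre_digraph"
    and V :: "nat \<Rightarrow> 'a set"
    and s :: "nat \<Rightarrow> nat"
    and r :: nat
  assumes "finite (pverts D)"
    and "connected D"
    and "complete_monotone_partite r V D"
    and "s r = card (V r)"
    and "\<And>i. 1 \<le> i \<Longrightarrow> i < r \<Longrightarrow> s i = max (1 + s (i + 1)) (card (V i))"
  shows "(\<exists>f. topological_additive_numbering D f) \<and>
         int (eta_t D) = (MAX i\<in>{1..r}. \<lceil>real (s i) / real (card (V i))\<rceil>)"
proof -
  define M where "M = (MAX i\<in>{1..r}. \<lceil>real (s i) / real (card (V i))\<rceil>)"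
  have r: "1 \<le> r"
    using assms(3) unfolding complete_monotone_partite_def by blast
  then have ne: "{1..r} \<noteq> {}"
    by simp
  \<comment> \<open>Since \<open>card (V i)\<close> is positive, the ceiling of the quotient is at
    most \<open>k\<close> iff \<open>s i \<le> k * card (V i)\<close>; thus \<open>M\<close> encodes
    all part conditions at once.\<close>
  have M_le: "M \<le> int k \<longleftrightarrow> (\<forall>i\<in>{1..r}. s i \<le> k * card (V i))" for k
  proof -
    have "\<lceil>real (s i) / real (card (V i))\<rceil> \<le> int k \<longleftrightarrow> s i \<le> k * card (V i)"
      if "i \<in> {1..r}" for i
    proof -
      have "\<lceil>real (s i) / real (card (V i))\<rceil> \<le> int k \<longleftrightarrow> real (s i) \<le> real (k * card (V i))"
        using card_part_pos[OF assms(1,3) that] by (simp add: ceiling_le_iff pos_divide_le_eq)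
      then show ?thesis
        by (simp only: of_nat_le_iff)
    qed
    then show ?thesis
      unfolding M_def using ne by (simp add: Max_le_iff)
  qed
  \<comment> \<open>Nonnegativity of \<open>M\<close> ensures that passing to \<open>nat M\<close>
    and back to integers loses nothing.\<close>
  have "0 \<le> \<lceil>real (s 1) / real (card (V 1))\<rceil>"
    by (simp add: le_ceiling_iff less_le_trans[of _ 0])
  also have "\<dots> \<le> M"
    unfolding M_def using r by (intro Max_ge) auto
  finally have M_nonneg: "0 \<le> M" .
  have bounded_iff:
    "(\<exists>f. topological_additive_numbering D f \<and> (\<forall>v\<in>pverts D. f v \<le> k)) \<longleftrightarrow> nat M \<le> k" for k
    using bounded_numbering_iff[OF assms(1,3-5)] M_le by (simp add: nat_le_iff)
  have "pverts D \<noteq> {}"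
    using pverts_eq[OF assms(1,3)] part_nonempty[OF assms(1,3), of 1] r by auto
  then have "eta_t D = nat M"
    using assms(1) bounded_iff by (intro eta_t_eqI)
  then show ?thesis
    \<comment> \<open>The instance \<open>k = nat M\<close> also supplies the existence of a
      numbering.\<close>
    using M_nonneg bounded_iff[of "nat M"] unfolding M_def by auto
qed

end
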